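(* Let $F=\mathbb C(a,b)$ be the field of rational functions in two variables over $\mathbb C$ and $\epsilon=\frac{-1+i\sqrt3}{2}$. Let $D_3$ be the $F$-algebra generated by $x,y$ subject to $x^3=a$, $y^3=b$, $yx=\epsilon xy$ (a central division $F$-algebra of degree $3$), with the involution $\ast$ which fixes $a,b,x,y$ and acts on $\mathbb C$ by complex conjugation. Let $K=F(x)$, a $\ast$-invariant maximal subfield, with $1,y,y^2$ a right $K$-basis of $D_3$. Then: (i) the involution $\ast$ on $D_3$ is formally real; (ii) the involution $X^\#=A^{-1}X^\ast A$ on $M_3(K)$, where $X^\ast$ is the transpose with $\ast$ applied entrywise and $A=\begin{pmatrix}1&0&0\\0&0&b\\0&b&0\end{pmatrix}$ (which is the involution extending $\ast$ under the left regular representation $D_3\to M_3(K)$ with respect to $1,y,y^2$, so that $(D_3\otimes_F K)\cong(M_3(K),\#)$), is not formally real.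
   Context: An involution $\#$ on a ring $R$ is formally real if every finite sum of nonzero elements of the form $rr^\#$ ($r\in R$) is nonzero. *)

theory Defs
  imports "HOL-Analysis.Analysis" "HOL-Computational_Algebra.Polynomial_Factorial"
begin

section \<open>Formally real involutions\<close>

text \<open>An involution inv on a ring (carrier S, addition add, multiplication mult, zero zero)
  is formally real if every finite (nonempty) sum of nonzero elements of the form
  r * inv r (r in S) is nonzero.\<close>
definition formally_real ::
  "'a set \<Rightarrow> ('a \<Rightarrow> 'a \<Rightarrow> 'a) \<Rightarrow> ('a \<Rightarrow> 'a \<Rightarrow> 'a) \<Rightarrow> 'a \<Rightarrow> ('a \<Rightarrow> 'a) \<Rightarrow> bool" where
  "formally_real S pl ml zr iv \<longleftrightarrow>
     (\<forall>rs. rs \<noteq> [] \<longrightarrow> set rs \<subseteq> S \<longrightarrow> (\<forall>r\<in>set rs. ml r (iv r) \<noteq> zr) \<longrightarrow>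
        foldr pl (map (\<lambda>r. ml r (iv r)) rs) zr \<noteq> zr)"

section \<open>The field C(s,t) of rational functions in two variables\<close>

text \<open>C(s,t) = Frac(C(s)[t]) with C(s) = Frac(C[s]).\<close>
type_synonym rat2 = "complex poly fract poly fract"

text \<open>Applying a map to numerator and denominator of a fraction.\<close>
definition map_fract :: "('a::idom \<Rightarrow> 'b::idom) \<Rightarrow> 'a fract \<Rightarrow> 'b fract" where
  "map_fract f q = (let p = (SOME p. snd p \<noteq> 0 \<and> q = Fract (fst p) (snd p))
                    in Fract (f (fst p)) (f (snd p)))"

definition cnj1 :: "complex poly fract \<Rightarrow> complex poly fract" where
  "cnj1 = map_fract (map_poly cnj)"

text \<open>Complex conjugation on the coefficients; fixes both variables.\<close>
definition cnj2 :: "rat2 \<Rightarrow> rat2" where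
  "cnj2 = map_fract (map_poly cnj1)"

definition const2 :: "complex \<Rightarrow> rat2" where
  "const2 c = to_fract [: to_fract [: c :] :]"

text \<open>The first (inner) variable s and the second (outer) variable t.\<close>
definition var_s :: rat2 where "var_s = to_fract [: to_fract [: 0, 1 :] :]"
definition var_t :: rat2 where "var_t = to_fract [: 0, 1 :]"

definition eps :: complex where "eps = (-1 + \<i> * sqrt 3) / 2"

section \<open>The symbol algebra D_3 over F = C(a,b)\<close>

text \<open>F = C(a,b), with a = var_s and b = var_t.  An element of D_3 is
  sum_{i,j<3} u(i,j) x^i y^j, represented by its coefficient function u
  (zero outside {0,1,2}^2).\<close>
definition aF :: rat2 where "aF = var_s"
definition bF :: rat2 where "bF = var_t"

definition D3 :: "(nat \<times> nat \<Rightarrow> rat2) set" where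
  "D3 = {u. \<forall>i j. (3 \<le> i \<or> 3 \<le> j) \<longrightarrow> u (i, j) = 0}"

definition d3_add :: "(nat \<times> nat \<Rightarrow> rat2) \<Rightarrow> (nat \<times> nat \<Rightarrow> rat2) \<Rightarrow> (nat \<times> nat \<Rightarrow> rat2)" where
  "d3_add u v = (\<lambda>p. u p + v p)"

definition d3_zero :: "nat \<times> nat \<Rightarrow> rat2" where
  "d3_zero = (\<lambda>_. 0)"

text \<open>(x^i y^j)(x^k y^l) = eps^(jk) x^(i+k) y^(j+l), reduced with x^3 = a, y^3 = b.\<close>
definition d3_mult :: "(nat \<times> nat \<Rightarrow> rat2) \<Rightarrow> (nat \<times> nat \<Rightarrow> rat2) \<Rightarrow> (nat \<times> nat \<Rightarrow> rat2)" where
  "d3_mult u v = (\<lambda>(p, q). if p < 3 \<and> q < 3 then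
      (\<Sum>i<3. \<Sum>j<3. \<Sum>k<3. \<Sum>l<3.
         if (i + k) mod 3 = p \<and> (j + l) mod 3 = q
         then const2 eps ^ (j * k) * aF ^ ((i + k) div 3) * bF ^ ((j + l) div 3) * u (i, j) * v (k, l)
         else 0)
    else 0)"

text \<open>The involution: (c x^i y^j)^* = y^j x^i cnj(c) = eps^(ij) cnj(c) x^i y^j.\<close>
definition d3_star :: "(nat \<times> nat \<Rightarrow> rat2) \<Rightarrow> (nat \<times> nat \<Rightarrow> rat2)" where
  "d3_star u = (\<lambda>(i, j). if i < 3 \<and> j < 3 then const2 eps ^ (i * j) * cnj2 (u (i, j)) else 0)"

section \<open>M_3(K) with K = F(x)\<close>

text \<open>K = F(x) with x^3 = a is identified with C(x,b) (a = x^3), i.e. again rat2,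
  now with x = var_s and b = var_t.  The involution * on K conjugates the complex
  coefficients and fixes x and b.\<close>
definition xK :: rat2 where "xK = var_s"
definition bK :: rat2 where "bK = var_t"

definition A_mat :: "rat2^3^3" where
  "A_mat = (\<chi> i j. if i = 0 \<and> j = 0 then 1
                   else if (i = 1 \<and> j = 2) \<or> (i = 2 \<and> j = 1) then bK else 0)"

definition star_conj_transpose :: "rat2^3^3 \<Rightarrow> rat2^3^3" where
  "star_conj_transpose X = (\<chi> i j. cnj2 (X $ j $ i))"

definition sharp :: "rat2^3^3 \<Rightarrow> rat2^3^3" where
  "sharp X = matrix_inv A_mat ** star_conj_transpose X ** A_mat"

end

theory Submission
  imports Defs "HOL-Computational_Algebra.Formal_Laurent_Series" "HOL-Computational_Algebra.Polynomial_FPS"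
begin

(* Proof idea.
   (i) Embed F = C(a,b) into the iterated Laurent series field C((s))((t)) via a = s, b = t.
   This embedding turns the involution on F into coefficientwise complex conjugation, and
   every nonzero series has a lexicographic leading term (t-order, then s-order, then
   coefficient) which is multiplicative and commutes with conjugation.  Give the monomial
   c x^i y^j of D_3 the weight (3 ord_t c + j, 3 ord_s c + i); distinct monomials of one
   element have weights that differ mod 3.  Take, among all monomials of all r in the sum,
   one of lexicographically minimal weight M.  In the coefficient of the sum of the r r^*
   at the monomial of weight 2M only the products of a weight-M monomial with its own
   conjugate contribute, each with the positive value |lc|^2 (times a common root of unity),
   so the sum is nonzero.
   (ii) An explicit computation: with E = E_11 and X = E_12 - b E_13 one gets
   E E^# = E and X X^# = -2 E, so E E^# + E E^# + X X^# = 0 with nonzero summands. *)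

section \<open>Ring embeddings\<close>

text \<open>Injective unital ring homomorphisms; the embeddings of F into Laurent series and the
  conjugation maps are all built from these by lifting to polynomials and fractions.\<close>
definition ring_embedding :: "('a::ring_1 \<Rightarrow> 'b::ring_1) \<Rightarrow> bool" where
  "ring_embedding f \<longleftrightarrow> (\<forall>x y. f (x + y) = f x + f y) \<and> (\<forall>x y. f (x * y) = f x * f y) \<and> f 1 = 1
     \<and> (\<forall>x. f x = 0 \<longleftrightarrow> x = 0)"

lemma ring_embeddingD:
  assumes "ring_embedding f"
  shows "f (x + y) = f x + f y" "f (x * y) = f x * f y" "f 1 = 1" "f x = 0 \<longleftrightarrow> x = 0" "f 0 = 0"
  using assms unfolding ring_embedding_def by auto

lemma ring_embedding_uminus: "ring_embedding f \<Longrightarrow> f (- x) = - f x"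
  by (metis add.right_inverse add_eq_0_iff ring_embeddingD(1,5))

lemma ring_embedding_power: "ring_embedding f \<Longrightarrow> f (x ^ n) = f x ^ n"
  by (induction n) (auto simp: ring_embeddingD)

lemma ring_embedding_sum: "ring_embedding f \<Longrightarrow> f (sum g A) = (\<Sum>a\<in>A. f (g a))"
  by (induction A rule: infinite_finite_induct) (auto simp: ring_embeddingD)

lemma ring_embedding_comp: "ring_embedding f \<Longrightarrow> ring_embedding g \<Longrightarrow> ring_embedding (f \<circ> g)"
  unfolding ring_embedding_def by auto

lemma ring_embedding_divide:
  fixes f :: "'a::field \<Rightarrow> 'b::field"
  assumes "ring_embedding f"
  shows "f (x / y) = f x / f y"
proof (cases "y = 0")
  case True
  then show ?thesis using assms by (simp add: ring_embeddingD)
next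
  case False
  have "f (x / y) * f y = f x" using False by (metis assms nonzero_divide_eq_eq ring_embeddingD(2))
  then show ?thesis using False assms by (simp add: ring_embeddingD field_simps)
qed

lemma ring_embedding_map_poly:
  fixes f :: "'a::idom \<Rightarrow> 'b::idom"
  assumes "ring_embedding f"
  shows "ring_embedding (map_poly f)"
proof -
  note f = ring_embeddingD[OF assms]
  have c: "coeff (map_poly f p) n = f (coeff p n)" for p n by (simp add: coeff_map_poly f)
  show ?thesis
    unfolding ring_embedding_def
    by (simp add: poly_eq_iff c f coeff_mult ring_embedding_sum[OF assms] coeff_1)
qed

lemma ring_embedding_to_fract: "ring_embedding to_fract"
  by (simp add: ring_embedding_def)

text \<open>map_fract (and fract_lift below) choose a representative of a fraction by Hilbert
  choice; this is the only fact needed about that choice.\<close>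
lemma fract_rep_choice:
  fixes a b :: "'a::idom"
  assumes "b \<noteq> 0"
  obtains a' b' where "(SOME p. snd p \<noteq> 0 \<and> Fract a b = Fract (fst p) (snd p)) = (a', b')"
    and "b' \<noteq> 0" and "a * b' = a' * b"
proof -
  define p where "p = (SOME p. snd p \<noteq> 0 \<and> Fract a b = Fract (fst p) (snd p))"
  have "snd p \<noteq> 0 \<and> Fract a b = Fract (fst p) (snd p)"
    unfolding p_def by (rule someI[of _ "(a, b)"]) (simp add: assms)
  then have "snd p \<noteq> 0" "a * snd p = fst p * b" using assms by (auto simp: eq_fract)
  then show ?thesis using that[of "fst p" "snd p"] by (simp add: p_def)
qed

text \<open>Extension of an embedding of a domain into a field to the fraction field.\<close>
definition fract_lift :: "('a::idom \<Rightarrow> 'b::field) \<Rightarrow> 'a fract \<Rightarrow> 'b" where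
  "fract_lift f q = (let p = (SOME p. snd p \<noteq> 0 \<and> q = Fract (fst p) (snd p))
                     in f (fst p) / f (snd p))"

lemma fract_lift_Fract:
  fixes f :: "'a::idom \<Rightarrow> 'b::field"
  assumes f: "ring_embedding f" and "b \<noteq> 0"
  shows "fract_lift f (Fract a b) = f a / f b"
proof -
  obtain a' b' where rep: "(SOME p. snd p \<noteq> 0 \<and> Fract a b = Fract (fst p) (snd p)) = (a', b')"
    "b' \<noteq> 0" "a * b' = a' * b"
    using fract_rep_choice[OF assms(2)] by blast
  have "f a * f b' = f a' * f b" using rep(3) by (metis ring_embeddingD(2)[OF f])
  then show ?thesis
    using rep(1,2) assms(2) by (simp add: fract_lift_def ring_embeddingD[OF f] field_simps)
qed

lemma ring_embedding_fract_lift: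
  fixes f :: "'a::idom \<Rightarrow> 'b::field"
  assumes f: "ring_embedding f"
  shows "ring_embedding (fract_lift f)"
proof -
  note h = ring_embeddingD[OF f]
  have F: "b \<noteq> 0 \<Longrightarrow> fract_lift f (Fract a b) = f a / f b" for a b
    by (rule fract_lift_Fract[OF f])
  show ?thesis
    unfolding ring_embedding_def
  proof (intro conjI allI)
    fix x y :: "'a fract"
    show "fract_lift f (x + y) = fract_lift f x + fract_lift f y"
      by (cases x, cases y) (simp add: F h field_simps)
    show "fract_lift f (x * y) = fract_lift f x * fract_lift f y"
      by (cases x, cases y) (simp add: F h)
    show "fract_lift f x = 0 \<longleftrightarrow> x = 0"
      by (cases x) (simp add: F h Zero_fract_def eq_fract)
  next
    show "fract_lift f 1 = 1" by (simp add: One_fract_def F h)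
  qed
qed

lemma fract_lift_to_fract: "ring_embedding f \<Longrightarrow> fract_lift f (to_fract a) = f a"
  by (simp add: to_fract_def fract_lift_Fract ring_embeddingD)

lemma map_fract_Fract:
  fixes f :: "'a::idom \<Rightarrow> 'b::idom"
  assumes f: "ring_embedding f" and "b \<noteq> 0"
  shows "map_fract f (Fract a b) = Fract (f a) (f b)"
proof -
  obtain a' b' where rep: "(SOME p. snd p \<noteq> 0 \<and> Fract a b = Fract (fst p) (snd p)) = (a', b')"
    "b' \<noteq> 0" "a * b' = a' * b"
    using fract_rep_choice[OF assms(2)] by blast
  have "f a' * f b = f a * f b'" using rep(3) by (metis ring_embeddingD(2)[OF f])
  then show ?thesis
    using rep(1,2) assms(2) by (simp add: map_fract_def ring_embeddingD[OF f] eq_fract)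
qed

text \<open>Applying an embedding to numerator and denominator is the same as lifting it, composed
  with the inclusion into the target fraction field; hence it is again an embedding.\<close>
lemma map_fract_eq_fract_lift:
  fixes f :: "'a::idom \<Rightarrow> 'b::idom"
  assumes f: "ring_embedding f"
  shows "map_fract f x = fract_lift (to_fract \<circ> f) x"
proof (cases x)
  case (Fract a b)
  have g: "ring_embedding (to_fract \<circ> f)" by (intro ring_embedding_comp ring_embedding_to_fract f)
  show ?thesis
    using Fract by (simp add: map_fract_Fract[OF f] fract_lift_Fract[OF g] ring_embeddingD[OF f]
        to_fract_def)
qed

lemma ring_embedding_map_fract:
  fixes f :: "'a::idom \<Rightarrow> 'b::idom"
  assumes "ring_embedding f"
  shows "ring_embedding (map_fract f)"
proof -
  have "map_fract f = fract_lift (to_fract \<circ> f)"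
    using map_fract_eq_fract_lift[OF assms] by blast
  then show ?thesis
    by (simp add: ring_embedding_fract_lift ring_embedding_comp ring_embedding_to_fract assms)
qed

lemma map_fract_to_fract: "ring_embedding f \<Longrightarrow> map_fract f (to_fract a) = to_fract (f a)"
  by (simp add: to_fract_def map_fract_Fract ring_embeddingD)

section \<open>Laurent series\<close>

text \<open>Coefficientwise application of a map to a Laurent series.\<close>
definition fls_cmap :: "('a::zero \<Rightarrow> 'b::zero) \<Rightarrow> 'a fls \<Rightarrow> 'b fls" where
  "fls_cmap h f = Abs_fls (\<lambda>n. h (fls_nth f n))"

lemma fls_cmap_nth: "h 0 = 0 \<Longrightarrow> fls_nth (fls_cmap h f) n = h (fls_nth f n)"
  unfolding fls_cmap_def
  by (rule nth_Abs_fls, rule eventually_mono[OF MOST_fls_neg_nth_eq_0[of f]]) simp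

lemma fls_cmap_subdegree:
  fixes h :: "'a::zero \<Rightarrow> 'b::zero"
  assumes "\<And>x. h x = 0 \<longleftrightarrow> x = 0"
  shows "fls_subdegree (fls_cmap h f) = fls_subdegree f"
proof (cases "f = 0")
  case True
  then have "fls_cmap h f = 0" using assms by (simp add: fls_eq_iff fls_cmap_nth)
  then show ?thesis using True by simp
next
  case False
  show ?thesis
    by (rule fls_subdegree_eqI) (use False assms in \<open>simp_all add: fls_cmap_nth\<close>)
qed

lemma ring_embedding_fls_cmap:
  fixes h :: "'a::idom \<Rightarrow> 'b::idom"
  assumes h: "ring_embedding h"
  shows "ring_embedding (fls_cmap h)"
proof -
  note r = ring_embeddingD[OF h]
  have N: "fls_nth (fls_cmap h f) n = h (fls_nth f n)" for f n by (simp add: fls_cmap_nth r)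
  have S: "fls_subdegree (fls_cmap h f) = fls_subdegree f" for f
    by (rule fls_cmap_subdegree) (simp add: r)
  show ?thesis
    unfolding ring_embedding_def
    by (simp add: fls_eq_iff N S fls_times_nth(2) ring_embedding_sum[OF h] r)
qed

text \<open>A polynomial viewed as a Laurent series.\<close>
definition poly_fls :: "'a::idom poly \<Rightarrow> 'a fls" where
  "poly_fls p = fps_to_fls (fps_of_poly p)"

lemma poly_fls_nth: "fls_nth (poly_fls p) n = (if n < 0 then 0 else coeff p (nat n))"
  by (simp add: poly_fls_def)

lemma ring_embedding_poly_fls: "ring_embedding poly_fls"
  unfolding ring_embedding_def poly_fls_def
  by (auto simp: fps_of_poly_add fps_of_poly_mult fls_times_fps_to_fls
      fps_of_poly_eq_iff[of _ 0, simplified])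

lemma poly_fls_const: "poly_fls [:c:] = fls_const c"
  by (auto simp: fls_eq_iff poly_fls_nth coeff_pCons split: nat.split)

lemma poly_fls_X: "poly_fls [:0, 1:] = fls_X"
  by (auto simp: fls_eq_iff poly_fls_nth coeff_pCons split: nat.split)

section \<open>Embedding C(a,b) into C((s))((t))\<close>

text \<open>iota1 : C(s) \<rightarrow> C((s)) and iota : C(s)(t) \<rightarrow> C((s))((t)).\<close>
definition iota1 :: "complex poly fract \<Rightarrow> complex fls" where
  "iota1 = fract_lift poly_fls"

definition iota :: "rat2 \<Rightarrow> complex fls fls" where
  "iota = fract_lift (poly_fls \<circ> map_poly iota1)"

lemma ring_embedding_iota1: "ring_embedding iota1"
  unfolding iota1_def by (intro ring_embedding_fract_lift ring_embedding_poly_fls)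

lemma ring_embedding_iota: "ring_embedding iota"
  unfolding iota_def
  by (intro ring_embedding_fract_lift ring_embedding_comp ring_embedding_poly_fls
      ring_embedding_map_poly ring_embedding_iota1)

lemma iota1_to_fract: "iota1 (to_fract p) = poly_fls p"
  unfolding iota1_def by (simp add: fract_lift_to_fract ring_embedding_poly_fls)

lemma iota_to_fract: "iota (to_fract p) = poly_fls (map_poly iota1 p)"
  unfolding iota_def
  by (simp add: fract_lift_to_fract ring_embedding_comp ring_embedding_poly_fls
      ring_embedding_map_poly ring_embedding_iota1)

lemma iota_const2: "iota (const2 c) = fls_const (fls_const c)"
  by (simp add: const2_def iota_to_fract iota1_to_fract poly_fls_const map_poly_pCons
      ring_embeddingD[OF ring_embedding_iota1])

lemma iota_aF: "iota aF = fls_const fls_X"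
  by (simp add: aF_def var_s_def iota_to_fract iota1_to_fract poly_fls_const poly_fls_X
      map_poly_pCons ring_embeddingD[OF ring_embedding_iota1])

lemma iota_bF: "iota bF = fls_X"
  by (simp add: bF_def var_t_def iota_to_fract ring_embeddingD[OF ring_embedding_iota1]
      map_poly_pCons poly_fls_X)

text \<open>Complex conjugation of all coefficients of C((s)) and C((s))((t)).\<close>
definition conj1_fls :: "complex fls \<Rightarrow> complex fls" where
  "conj1_fls = fls_cmap cnj"

definition conj2_fls :: "complex fls fls \<Rightarrow> complex fls fls" where
  "conj2_fls = fls_cmap conj1_fls"

lemma ring_embedding_cnj: "ring_embedding cnj"
  by (simp add: ring_embedding_def)

lemma ring_embedding_cnj1: "ring_embedding cnj1"
  unfolding cnj1_def by (intro ring_embedding_map_fract ring_embedding_map_poly ring_embedding_cnj)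

lemma ring_embedding_cnj2: "ring_embedding cnj2"
  unfolding cnj2_def by (intro ring_embedding_map_fract ring_embedding_map_poly ring_embedding_cnj1)

lemma ring_embedding_conj1_fls: "ring_embedding conj1_fls"
  unfolding conj1_fls_def by (intro ring_embedding_fls_cmap ring_embedding_cnj)

lemma ring_embedding_conj2_fls: "ring_embedding conj2_fls"
  unfolding conj2_fls_def by (intro ring_embedding_fls_cmap ring_embedding_conj1_fls)

lemma poly_fls_map_cnj: "poly_fls (map_poly cnj p) = conj1_fls (poly_fls p)"
  by (simp add: fls_eq_iff poly_fls_nth conj1_fls_def fls_cmap_nth coeff_map_poly)

lemma iota1_cnj1: "iota1 (cnj1 q) = conj1_fls (iota1 q)"
proof (cases q)
  case (Fract a b)
  note cnj_poly = ring_embedding_map_poly[OF ring_embedding_cnj]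
  have "iota1 (cnj1 q) = poly_fls (map_poly cnj a) / poly_fls (map_poly cnj b)"
    using Fract by (simp add: cnj1_def map_fract_Fract[OF cnj_poly] iota1_def fract_lift_Fract
        ring_embedding_poly_fls ring_embeddingD(4)[OF cnj_poly])
  also have "\<dots> = conj1_fls (poly_fls a / poly_fls b)"
    by (simp add: poly_fls_map_cnj ring_embedding_divide[OF ring_embedding_conj1_fls])
  also have "\<dots> = conj1_fls (iota1 q)"
    using Fract by (simp add: iota1_def fract_lift_Fract ring_embedding_poly_fls)
  finally show ?thesis .
qed

lemma poly_fls_map_cnj1:
  "poly_fls (map_poly iota1 (map_poly cnj1 p)) = conj2_fls (poly_fls (map_poly iota1 p))"
  by (simp add: fls_eq_iff poly_fls_nth conj2_fls_def fls_cmap_nth coeff_map_poly iota1_cnj1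
      ring_embeddingD[OF ring_embedding_iota1] ring_embeddingD[OF ring_embedding_conj1_fls]
      ring_embeddingD[OF ring_embedding_cnj1])

text \<open>The embedding transports the involution of F to coefficientwise conjugation.\<close>
lemma iota_cnj2: "iota (cnj2 q) = conj2_fls (iota q)"
proof (cases q)
  case (Fract a b)
  define \<phi> where "\<phi> = poly_fls \<circ> map_poly iota1"
  have \<phi>: "ring_embedding \<phi>"
    unfolding \<phi>_def
    by (intro ring_embedding_comp ring_embedding_poly_fls ring_embedding_map_poly ring_embedding_iota1)
  note cnj_poly = ring_embedding_map_poly[OF ring_embedding_cnj1]
  have "iota (cnj2 q) = \<phi> (map_poly cnj1 a) / \<phi> (map_poly cnj1 b)"
    using Fract by (simp add: cnj2_def map_fract_Fract[OF cnj_poly] iota_def \<phi>_def[symmetric]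
        fract_lift_Fract[OF \<phi>] ring_embeddingD(4)[OF cnj_poly])
  also have "\<dots> = conj2_fls (\<phi> a / \<phi> b)"
    by (simp add: \<phi>_def poly_fls_map_cnj1 ring_embedding_divide[OF ring_embedding_conj2_fls])
  also have "\<dots> = conj2_fls (iota q)"
    using Fract by (simp add: iota_def \<phi>_def[symmetric] fract_lift_Fract[OF \<phi>])
  finally show ?thesis .
qed

section \<open>Lexicographic leading terms in C((s))((t))\<close>

text \<open>For g \<noteq> 0: its t-order, the leading t-coefficient (a series in s), the s-order of
  that coefficient, and the resulting leading complex coefficient.\<close>
definition ord_t :: "complex fls fls \<Rightarrow> int" where "ord_t g = fls_subdegree g"
definition lead_t :: "complex fls fls \<Rightarrow> complex fls" where "lead_t g = fls_nth g (ord_t g)"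
definition ord_s :: "complex fls fls \<Rightarrow> int" where "ord_s g = fls_subdegree (lead_t g)"
definition lcoeff :: "complex fls fls \<Rightarrow> complex" where "lcoeff g = fls_nth (lead_t g) (ord_s g)"

text \<open>The coefficient of t^m1 s^m2.\<close>
definition coeff2 :: "complex fls fls \<Rightarrow> int \<Rightarrow> int \<Rightarrow> complex" where
  "coeff2 g m1 m2 = fls_nth (fls_nth g m1) m2"

lemma lead_t_nonzero: "g \<noteq> 0 \<Longrightarrow> lead_t g \<noteq> 0"
  by (simp add: lead_t_def ord_t_def)

lemma lcoeff_nonzero: "g \<noteq> 0 \<Longrightarrow> lcoeff g \<noteq> 0"
  by (simp add: lcoeff_def ord_s_def lead_t_nonzero)

lemma lead_mult:
  assumes "g \<noteq> 0" "h \<noteq> 0"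
  shows "ord_t (g * h) = ord_t g + ord_t h" "ord_s (g * h) = ord_s g + ord_s h"
    "lcoeff (g * h) = lcoeff g * lcoeff h"
proof -
  show 1: "ord_t (g * h) = ord_t g + ord_t h" using assms by (simp add: ord_t_def)
  have 2: "lead_t (g * h) = lead_t g * lead_t h"
    unfolding lead_t_def 1 by (simp add: ord_t_def fls_times_base)
  show 3: "ord_s (g * h) = ord_s g + ord_s h"
    unfolding ord_s_def 2 using lead_t_nonzero[OF assms(1)] lead_t_nonzero[OF assms(2)] by simp
  show "lcoeff (g * h) = lcoeff g * lcoeff h"
    unfolding lcoeff_def 2 3 by (simp add: ord_s_def fls_times_base)
qed

lemma lead_power:
  assumes "g \<noteq> 0"
  shows "ord_t (g ^ n) = int n * ord_t g \<and> ord_s (g ^ n) = int n * ord_s g \<and>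
    lcoeff (g ^ n) = lcoeff g ^ n"
proof (induction n)
  case 0
  then show ?case by (simp add: ord_t_def ord_s_def lead_t_def lcoeff_def)
next
  case (Suc n)
  have "g ^ n \<noteq> 0" using assms by simp
  then show ?case using Suc by (simp add: lead_mult[OF assms] algebra_simps)
qed

lemma lead_conj2:
  "ord_t (conj2_fls g) = ord_t g" "ord_s (conj2_fls g) = ord_s g" "lcoeff (conj2_fls g) = cnj (lcoeff g)"
proof -
  note c1 = ring_embeddingD[OF ring_embedding_conj1_fls]
  show 1: "ord_t (conj2_fls g) = ord_t g"
    unfolding ord_t_def conj2_fls_def by (rule fls_cmap_subdegree) (simp add: c1)
  have 2: "lead_t (conj2_fls g) = conj1_fls (lead_t g)"
    unfolding lead_t_def 1 by (simp add: conj2_fls_def fls_cmap_nth c1)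
  show 3: "ord_s (conj2_fls g) = ord_s g"
    unfolding ord_s_def 2 conj1_fls_def by (rule fls_cmap_subdegree) simp
  show "lcoeff (conj2_fls g) = cnj (lcoeff g)"
    unfolding lcoeff_def 2 3 by (simp add: conj1_fls_def fls_cmap_nth)
qed

lemma lead_const:
  "c \<noteq> 0 \<Longrightarrow> ord_t (fls_const (fls_const c)) = 0 \<and> ord_s (fls_const (fls_const c)) = 0 \<and>
    lcoeff (fls_const (fls_const c)) = c"
  by (simp add: ord_t_def ord_s_def lead_t_def lcoeff_def)

lemma lead_var_s: "ord_t (fls_const fls_X) = 0 \<and> ord_s (fls_const fls_X) = 1 \<and> lcoeff (fls_const fls_X) = 1"
  by (simp add: ord_t_def ord_s_def lead_t_def lcoeff_def)

lemma lead_var_t: "ord_t fls_X = 1 \<and> ord_s fls_X = 0 \<and> lcoeff fls_X = 1"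
  by (simp add: ord_t_def ord_s_def lead_t_def lcoeff_def)

text \<open>Coefficients lexicographically below the leading exponent vanish.\<close>
lemma coeff2_below_lead:
  assumes "g \<noteq> 0" "m1 < ord_t g \<or> (m1 = ord_t g \<and> m2 < ord_s g)"
  shows "coeff2 g m1 m2 = 0"
  using assms by (auto simp: coeff2_def ord_t_def ord_s_def lead_t_def)

lemma coeff2_lead: "coeff2 g (ord_t g) (ord_s g) = lcoeff g"
  by (simp add: coeff2_def lcoeff_def lead_t_def)

lemma coeff2_add: "coeff2 (g + h) m1 m2 = coeff2 g m1 m2 + coeff2 h m1 m2"
  by (simp add: coeff2_def)

lemma coeff2_zero: "coeff2 0 m1 m2 = 0"
  by (simp add: coeff2_def)

lemma coeff2_iota_sum: "coeff2 (iota (sum g A)) m1 m2 = (\<Sum>a\<in>A. coeff2 (iota (g a)) m1 m2)"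
  by (induction A rule: infinite_finite_induct)
    (auto simp: ring_embeddingD[OF ring_embedding_iota] coeff2_add coeff2_zero)

lemma coeff2_iota_sum_list:
  "coeff2 (iota (sum_list xs)) m1 m2 = sum_list (map (\<lambda>x. coeff2 (iota x) m1 m2) xs)"
  by (induction xs) (auto simp: ring_embeddingD[OF ring_embedding_iota] coeff2_add coeff2_zero)

section \<open>Leading terms of r r^* in D_3\<close>

lemma eps_nonzero: "eps \<noteq> 0"
proof
  assume "eps = 0"
  then have "Re eps = 0" by simp
  then show False by (simp add: eps_def)
qed

text \<open>The summand of d3_mult contributed by x^i y^j \<cdot> x^k y^l at position x^p y^q.\<close>
definition d3_mult_term ::
  "(nat \<times> nat \<Rightarrow> rat2) \<Rightarrow> (nat \<times> nat \<Rightarrow> rat2) \<Rightarrow> nat \<Rightarrow> nat \<Rightarrow> nat \<Rightarrow> nat \<Rightarrow> nat \<Rightarrow> nat \<Rightarrow> rat2" where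
  "d3_mult_term u v p q i j k l =
     (if (i + k) mod 3 = p \<and> (j + l) mod 3 = q
      then const2 eps ^ (j * k) * aF ^ ((i + k) div 3) * bF ^ ((j + l) div 3) * u (i, j) * v (k, l)
      else 0)"

lemma d3_mult_eq:
  "p < 3 \<Longrightarrow> q < 3 \<Longrightarrow>
    d3_mult u v (p, q) = (\<Sum>i<3. \<Sum>j<3. \<Sum>k<3. \<Sum>l<3. d3_mult_term u v p q i j k l)"
  by (simp add: d3_mult_def d3_mult_term_def)

text \<open>Weight of the monomial r(i,j) x^i y^j, with x of weight (0,1) and y of weight (1,0) in
  units where t and s have weight 3; the residues mod 3 recover (j, i).\<close>
definition weight :: "(nat \<times> nat \<Rightarrow> rat2) \<Rightarrow> nat \<Rightarrow> nat \<Rightarrow> int \<times> int" where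
  "weight r i j = (3 * ord_t (iota (r (i, j))) + int j, 3 * ord_s (iota (r (i, j))) + int i)"

definition lex_le :: "int \<times> int \<Rightarrow> int \<times> int \<Rightarrow> bool" where
  "lex_le a b \<longleftrightarrow> fst a < fst b \<or> (fst a = fst b \<and> snd a \<le> snd b)"

lemma weight_mod: "i < 3 \<Longrightarrow> j < 3 \<Longrightarrow> fst (weight r i j) mod 3 = int j \<and> snd (weight r i j) mod 3 = int i"
  by (simp add: weight_def)

text \<open>Every finite nonempty set has an element of lexicographically minimal f-value.\<close>
lemma lex_min:
  assumes "finite A" "A \<noteq> {}"
  shows "\<exists>x\<in>A. \<forall>y\<in>A. lex_le (f x) (f y)"
  using assms
proof (induction A rule: finite_ne_induct)
  case (singleton x)
  then show ?case by (auto simp: lex_le_def)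
next
  case (insert x F)
  then obtain m where m: "m \<in> F" "\<forall>y\<in>F. lex_le (f m) (f y)" by blast
  show ?case
  proof (cases "lex_le (f m) (f x)")
    case True
    then show ?thesis using m by auto
  next
    case False
    then have "\<forall>y\<in>F. lex_le (f x) (f y)" using m(2) by (auto simp: lex_le_def)
    then show ?thesis by (auto simp: lex_le_def)
  qed
qed

text \<open>If two weights are lexicographically \<ge> M and not both equal to M, their sum exceeds 2M.\<close>
lemma lex_sum_strict:
  assumes "lex_le M A" "lex_le M B" "\<not> (A = M \<and> B = M)"
  shows "2 * fst M < fst A + fst B \<or> (2 * fst M = fst A + fst B \<and> 2 * snd M < snd A + snd B)"
  using assms unfolding lex_le_def by (cases A, cases B, cases M) auto

text \<open>A nonzero product term of r r^* has weight equal to the sum of the weights of its two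
  factors, and its leading coefficient is eps-twisted lc(r(i,j)) \<cdot> conj(lc(r(k,l))).\<close>
lemma lead_d3_mult_term:
  fixes r :: "nat \<times> nat \<Rightarrow> rat2"
  assumes kl: "k < 3" "l < 3" and nz: "r (i, j) \<noteq> 0" "r (k, l) \<noteq> 0"
    and pq: "(i + k) mod 3 = p" "(j + l) mod 3 = q"
  defines "G \<equiv> iota (d3_mult_term r (d3_star r) p q i j k l)"
  shows "G \<noteq> 0" "3 * ord_t G + int q = fst (weight r i j) + fst (weight r k l)"
    "3 * ord_s G + int p = snd (weight r i j) + snd (weight r k l)"
    "lcoeff G = eps ^ (j * k + k * l) * lcoeff (iota (r (i, j))) * cnj (lcoeff (iota (r (k, l))))"
proof -
  define gi gk where "gi = iota (r (i, j))" and "gk = iota (r (k, l))"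
  note \<iota> = ring_embeddingD[OF ring_embedding_iota]
  have gi: "gi \<noteq> 0" and gk: "gk \<noteq> 0" "conj2_fls gk \<noteq> 0"
    using nz by (simp_all add: gi_def gk_def \<iota> ring_embeddingD[OF ring_embedding_conj2_fls])
  define e where "e = (fls_const (fls_const eps) :: complex fls fls)"
  have e: "e \<noteq> 0" "e ^ n \<noteq> 0" for n using eps_nonzero by (simp_all add: e_def)
  have x: "fls_const fls_X ^ n \<noteq> (0 :: complex fls fls)" "fls_X ^ n \<noteq> (0 :: complex fls fls)" for n
    by simp_all
  have G: "G = e ^ (j * k) * fls_const fls_X ^ ((i + k) div 3) * fls_X ^ ((j + l) div 3) * gi *
      (e ^ (k * l) * conj2_fls gk)"
    using kl pq by (simp add: G_def d3_mult_term_def d3_star_def \<iota> ring_embedding_power[OF ring_embedding_iota]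
        iota_const2 iota_aF iota_bF iota_cnj2 e_def gi_def gk_def)
  note P = lead_power[OF e(1)] lead_power[of "fls_const fls_X"] lead_power[OF fls_X_nonzero]
  have lead: "G \<noteq> 0 \<and> ord_t G = int ((j + l) div 3) + ord_t gi + ord_t gk \<and>
      ord_s G = int ((i + k) div 3) + ord_s gi + ord_s gk \<and>
      lcoeff G = eps ^ (j * k) * lcoeff gi * (eps ^ (k * l) * cnj (lcoeff gk))"
    unfolding G using gi gk e x
    by (simp add: lead_mult P lead_const[OF eps_nonzero, folded e_def] lead_var_s lead_var_t lead_conj2)
  have "int j + int l = 3 * int ((j + l) div 3) + int q" "int i + int k = 3 * int ((i + k) div 3) + int p"
    using pq div_mult_mod_eq[of "j + l" 3] div_mult_mod_eq[of "i + k" 3] by linarith+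
  then show "G \<noteq> 0" "3 * ord_t G + int q = fst (weight r i j) + fst (weight r k l)"
    "3 * ord_s G + int p = snd (weight r i j) + snd (weight r k l)"
    "lcoeff G = eps ^ (j * k + k * l) * lcoeff (iota (r (i, j))) * cnj (lcoeff (iota (r (k, l))))"
    using lead by (simp_all add: weight_def gi_def gk_def power_add mult_ac)
qed

text \<open>The data attached to a minimal weight M: the monomial x^is y^js carrying it, the position
  (p, q) of its square x^(2 is) y^(2 js), and the series exponent (m1, m2) of weight 2M there.\<close>
definition center :: "int \<times> int \<Rightarrow> nat \<Rightarrow> nat \<Rightarrow> nat \<Rightarrow> nat \<Rightarrow> int \<Rightarrow> int \<Rightarrow> bool" where
  "center M is js p q m1 m2 \<longleftrightarrow> int is = snd M mod 3 \<and> int js = fst M mod 3 \<and>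
     p = (2 * is) mod 3 \<and> q = (2 * js) mod 3 \<and> 3 * m1 + int q = 2 * fst M \<and> 3 * m2 + int p = 2 * snd M"

lemma center_exists: "\<exists>is js p q m1 m2. center M is js p q m1 m2"
proof -
  define "is" js where "is = nat (snd M mod 3)" and "js = nat (fst M mod 3)"
  define p q where "p = (2 * is) mod 3" and "q = (2 * js) mod 3"
  have "int q = (2 * (fst M mod 3)) mod 3" "int p = (2 * (snd M mod 3)) mod 3"
    by (simp_all add: p_def q_def is_def js_def zmod_int)
  then have "3 * ((2 * fst M - int q) div 3) + int q = 2 * fst M"
    "3 * ((2 * snd M - int p) div 3) + int p = 2 * snd M" by presburger+
  then show ?thesis
    unfolding center_def by (metis is_def js_def p_def q_def pos_mod_sign nat_0_le zero_less_numeral)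
qed

lemma center_bounds: "center M is js p q m1 m2 \<Longrightarrow> is < 3 \<and> js < 3 \<and> p < 3 \<and> q < 3"
  unfolding center_def by (metis of_nat_less_iff of_nat_numeral pos_mod_bound zero_less_numeral mod_less_divisor)

text \<open>At the center of a lower bound M of all weights of r, a product term of r r^* contributes
  only if both factors are the weight-M monomial itself, and then its leading coefficient.\<close>
lemma coeff2_d3_mult_term:
  fixes r :: "nat \<times> nat \<Rightarrow> rat2"
  assumes Mmin: "\<And>i j. i < 3 \<Longrightarrow> j < 3 \<Longrightarrow> r (i, j) \<noteq> 0 \<Longrightarrow> lex_le M (weight r i j)"
    and ijkl: "i < 3" "j < 3" "k < 3" "l < 3" and c: "center M is js p q m1 m2"
  shows "coeff2 (iota (d3_mult_term r (d3_star r) p q i j k l)) m1 m2 =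
     (if i = is \<and> j = js \<and> k = is \<and> l = js \<and> r (is, js) \<noteq> 0 \<and> weight r is js = M
      then eps ^ (js * is + is * js) * lcoeff (iota (r (is, js))) * cnj (lcoeff (iota (r (is, js))))
      else 0)"
proof (cases "(i + k) mod 3 = p \<and> (j + l) mod 3 = q \<and> r (i, j) \<noteq> 0 \<and> r (k, l) \<noteq> 0")
  case False
  have "d3_mult_term r (d3_star r) p q i j k l = 0"
    using False by (auto simp: d3_mult_term_def d3_star_def ring_embeddingD[OF ring_embedding_cnj2])
  moreover have "\<not> (i = is \<and> j = js \<and> k = is \<and> l = js \<and> r (is, js) \<noteq> 0)"
    using False c unfolding center_def by (metis mult_2)
  ultimately show ?thesis by (auto simp: ring_embeddingD[OF ring_embedding_iota] coeff2_zero)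
next
  case True
  then have pq: "(i + k) mod 3 = p" "(j + l) mod 3 = q" and nz: "r (i, j) \<noteq> 0" "r (k, l) \<noteq> 0"
    by auto
  define G where "G = iota (d3_mult_term r (d3_star r) p q i j k l)"
  note G = lead_d3_mult_term[OF ijkl(3,4) nz pq, folded G_def]
  show ?thesis
  proof (cases "weight r i j = M \<and> weight r k l = M")
    case both: True
    have idx: "i = is" "j = js" "k = is" "l = js"
      using weight_mod[OF ijkl(1,2), of r] weight_mod[OF ijkl(3,4), of r] both c
      unfolding center_def by auto
    have "ord_t G = m1" "ord_s G = m2" using G(2,3) both c unfolding center_def by auto
    then have "coeff2 G m1 m2 = lcoeff G" using coeff2_lead by metis
    then show ?thesis unfolding G_def[symmetric] using G(4) idx both nz by simp
  next
    case notM: False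
    have "lex_le M (weight r i j)" "lex_le M (weight r k l)" using Mmin ijkl nz by auto
    from lex_sum_strict[OF this notM]
    have "m1 < ord_t G \<or> (m1 = ord_t G \<and> m2 < ord_s G)" using G(2,3) c unfolding center_def by auto
    then have "coeff2 G m1 m2 = 0" by (rule coeff2_below_lead[OF G(1)])
    moreover have "\<not> (i = is \<and> j = js \<and> k = is \<and> l = js \<and> weight r is js = M)" using notM by auto
    ultimately show ?thesis unfolding G_def[symmetric] by auto
  qed
qed

lemma sum_four_delta:
  assumes "is < 3" "js < 3"
  shows "(\<Sum>i<3::nat. \<Sum>j<3::nat. \<Sum>k<3::nat. \<Sum>l<3::nat.
     if i = is \<and> j = js \<and> k = is \<and> l = js \<and> c then (L::complex) else 0) = (if c then L else 0)"
proof -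
  have "(\<Sum>l<3::nat. if i = is \<and> j = js \<and> k = is \<and> l = js \<and> c then L else 0)
      = (if i = is \<and> j = js \<and> k = is \<and> c then L else 0)" for i j k
    using assms by (auto simp: sum.delta')
  moreover have "(\<Sum>k<3::nat. if i = is \<and> j = js \<and> k = is \<and> c then L else 0)
      = (if i = is \<and> j = js \<and> c then L else 0)" for i j
    using assms by (auto simp: sum.delta')
  moreover have "(\<Sum>j<3::nat. if i = is \<and> j = js \<and> c then L else 0) = (if i = is \<and> c then L else 0)" for i
    using assms by (auto simp: sum.delta')
  ultimately show ?thesis using assms by (auto simp: sum.delta')
qed

text \<open>Key computation: at the center of a lower bound M of its weights, the coefficient of r r^*
  is |lc|^2 (up to a root of unity) if M is attained by r, and zero otherwise.\<close>
lemma coeff2_mult_star: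
  fixes r :: "nat \<times> nat \<Rightarrow> rat2"
  assumes Mmin: "\<And>i j. i < 3 \<Longrightarrow> j < 3 \<Longrightarrow> r (i, j) \<noteq> 0 \<Longrightarrow> lex_le M (weight r i j)"
    and c: "center M is js p q m1 m2"
  shows "coeff2 (iota (d3_mult r (d3_star r) (p, q))) m1 m2 =
    (if r (is, js) \<noteq> 0 \<and> weight r is js = M
     then eps ^ (js * is + is * js) * complex_of_real ((cmod (lcoeff (iota (r (is, js)))))\<^sup>2)
     else 0)"
proof -
  have b: "is < 3" "js < 3" "p < 3" "q < 3" using center_bounds[OF c] by auto
  have "coeff2 (iota (d3_mult r (d3_star r) (p, q))) m1 m2 =
    (\<Sum>i<3::nat. \<Sum>j<3::nat. \<Sum>k<3::nat. \<Sum>l<3::nat.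
      if i = is \<and> j = js \<and> k = is \<and> l = js \<and> r (is, js) \<noteq> 0 \<and> weight r is js = M
      then eps ^ (js * is + is * js) * lcoeff (iota (r (is, js))) * cnj (lcoeff (iota (r (is, js))))
      else 0)"
    unfolding d3_mult_eq[OF b(3,4)] coeff2_iota_sum
    by (intro sum.cong refl coeff2_d3_mult_term[OF Mmin _ _ _ _ c]) auto
  also have "\<dots> = (if r (is, js) \<noteq> 0 \<and> weight r is js = M
      then eps ^ (js * is + is * js) * lcoeff (iota (r (is, js))) * cnj (lcoeff (iota (r (is, js))))
      else 0)"
    by (rule sum_four_delta[OF b(1,2)])
  finally show ?thesis by (simp only: complex_norm_square mult.assoc)
qed

section \<open>Part (i): the involution on D_3 is formally real\<close>

text \<open>Elementary list facts used to evaluate the sum \<Sum> r r^* coefficientwise.\<close>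
lemma foldr_d3_add: "foldr d3_add (map f rs) d3_zero x = sum_list (map (\<lambda>r. f r x) rs)"
  by (induction rs) (auto simp: d3_add_def d3_zero_def)

lemma sum_list_if_pull:
  "sum_list (map (\<lambda>r. if P r then c * complex_of_real (h r) else 0) xs) =
   c * complex_of_real (sum_list (map (\<lambda>r. if P r then h r else 0) xs))"
  by (induction xs) (auto simp: algebra_simps)

lemma sum_list_pos:
  fixes g :: "'a \<Rightarrow> real"
  assumes "\<forall>x\<in>set xs. 0 \<le> g x" "y \<in> set xs" "0 < g y"
  shows "0 < sum_list (map g xs)"
proof -
  have "0 \<le> sum_list (map g (remove1 y xs))"
    using assms(1) by (intro sum_list_nonneg) (auto dest: subsetD[OF set_remove1_subset])
  then show ?thesis using sum_list_map_remove1[OF assms(2), of g] assms(3) by simp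
qed

text \<open>An element without nonzero coefficients annihilates everything.\<close>
lemma d3_mult_zero_left: "\<forall>i<3. \<forall>j<3. r (i, j) = 0 \<Longrightarrow> d3_mult r v = d3_zero"
  by (auto simp: d3_mult_def d3_zero_def fun_eq_iff intro!: sum.neutral)

text \<open>Among all monomials of a nonempty list of elements with r r^* \<noteq> 0 there is one of
  lexicographically minimal weight.\<close>
lemma min_weight_exists:
  assumes "rs \<noteq> []" "\<forall>r\<in>set rs. d3_mult r (d3_star r) \<noteq> d3_zero"
  obtains r0 i0 j0 where "r0 \<in> set rs" "i0 < 3" "j0 < 3" "r0 (i0, j0) \<noteq> 0"
    "\<And>r i j. r \<in> set rs \<Longrightarrow> i < 3 \<Longrightarrow> j < 3 \<Longrightarrow> r (i, j) \<noteq> 0 \<Longrightarrow> lex_le (weight r0 i0 j0) (weight r i j)"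
proof -
  define A where "A = {(r, i, j). r \<in> set rs \<and> i < 3 \<and> j < (3::nat) \<and> r (i, j) \<noteq> 0}"
  have "A \<subseteq> set rs \<times> {..<3} \<times> {..<3}" by (auto simp: A_def)
  then have fin: "finite A" by (rule finite_subset) auto
  obtain r1 where r1: "r1 \<in> set rs" using assms(1) by (cases rs) auto
  then obtain i1 j1 where "i1 < 3" "j1 < 3" "r1 (i1, j1) \<noteq> 0"
    using assms(2) d3_mult_zero_left by blast
  then have "A \<noteq> {}" using r1 by (auto simp: A_def)
  then obtain x0 where x0: "x0 \<in> A"
    "\<forall>y\<in>A. lex_le ((\<lambda>(r, i, j). weight r i j) x0) ((\<lambda>(r, i, j). weight r i j) y)"
    using lex_min[OF fin] by blast
  obtain r0 i0 j0 where x0e: "x0 = (r0, i0, j0)" by (cases x0) auto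
  show ?thesis
    by (rule that[of r0 i0 j0]) (use x0 in \<open>auto simp: A_def x0e\<close>)
qed

text \<open>Summing the key computation over the list: the coefficient of \<Sum> r r^* at the center of
  the minimal weight is a root of unity times a sum of squared moduli.\<close>
lemma coeff2_sum_mult_star:
  assumes Mmin: "\<And>r i j. r \<in> set rs \<Longrightarrow> i < 3 \<Longrightarrow> j < 3 \<Longrightarrow> r (i, j) \<noteq> 0 \<Longrightarrow> lex_le M (weight r i j)"
    and c: "center M is js p q m1 m2"
  shows "coeff2 (iota (foldr d3_add (map (\<lambda>r. d3_mult r (d3_star r)) rs) d3_zero (p, q))) m1 m2 =
    eps ^ (js * is + is * js) * complex_of_real (sum_list (map (\<lambda>r.
      if r (is, js) \<noteq> 0 \<and> weight r is js = M then (cmod (lcoeff (iota (r (is, js)))))\<^sup>2 else 0) rs))"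
proof -
  have "coeff2 (iota (foldr d3_add (map (\<lambda>r. d3_mult r (d3_star r)) rs) d3_zero (p, q))) m1 m2 =
      sum_list (map (\<lambda>r. coeff2 (iota (d3_mult r (d3_star r) (p, q))) m1 m2) rs)"
    by (simp add: foldr_d3_add coeff2_iota_sum_list o_def)
  also have "\<dots> = sum_list (map (\<lambda>r. if r (is, js) \<noteq> 0 \<and> weight r is js = M
      then eps ^ (js * is + is * js) * complex_of_real ((cmod (lcoeff (iota (r (is, js)))))\<^sup>2) else 0) rs)"
    using coeff2_mult_star[OF Mmin c] by (intro arg_cong[where f = sum_list] map_cong) auto
  finally show ?thesis by (simp only: sum_list_if_pull)
qed

text \<open>Part (i).\<close>
theorem d3_star_formally_real: "formally_real D3 d3_add d3_mult d3_zero d3_star"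
  unfolding formally_real_def
proof (intro allI impI)
  fix rs :: "(nat \<times> nat \<Rightarrow> rat2) list"
  assume ne: "rs \<noteq> []" and "set rs \<subseteq> D3" and nz: "\<forall>r\<in>set rs. d3_mult r (d3_star r) \<noteq> d3_zero"
  obtain r0 i0 j0 where r0: "r0 \<in> set rs" "i0 < 3" "j0 < 3" "r0 (i0, j0) \<noteq> 0"
    and Mmin: "\<And>r i j. r \<in> set rs \<Longrightarrow> i < 3 \<Longrightarrow> j < 3 \<Longrightarrow> r (i, j) \<noteq> 0 \<Longrightarrow>
      lex_le (weight r0 i0 j0) (weight r i j)"
    using min_weight_exists[OF ne nz] by blast
  obtain "is" js p q m1 m2 where c: "center (weight r0 i0 j0) is js p q m1 m2"
    using center_exists by blast
  then have "is = i0" "js = j0" using weight_mod[OF r0(2,3), of r0] by (auto simp: center_def)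
  then have "lcoeff (iota (r0 (is, js))) \<noteq> 0"
    using r0(4) by (simp add: lcoeff_nonzero ring_embeddingD[OF ring_embedding_iota])
  then have "0 < sum_list (map (\<lambda>r. if r (is, js) \<noteq> 0 \<and> weight r is js = weight r0 i0 j0
      then (cmod (lcoeff (iota (r (is, js)))))\<^sup>2 else 0) rs)"
    using r0 \<open>is = i0\<close> \<open>js = j0\<close> by (intro sum_list_pos[OF _ r0(1)]) auto
  then have "coeff2 (iota (foldr d3_add (map (\<lambda>r. d3_mult r (d3_star r)) rs) d3_zero (p, q))) m1 m2 \<noteq> 0"
    using coeff2_sum_mult_star[OF Mmin c] eps_nonzero by simp
  then show "foldr d3_add (map (\<lambda>r. d3_mult r (d3_star r)) rs) d3_zero \<noteq> d3_zero"
    by (auto simp: d3_zero_def ring_embeddingD[OF ring_embedding_iota] coeff2_zero)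
qed

section \<open>Part (ii): the involution # on M_3(K) is not formally real\<close>

text \<open>Finite sums and quantifiers over the index type 3 of 3 \<times> 3 matrices.\<close>
lemma three_eq_0: "(3::3) = 0" by simp

lemma forall_3': "(\<forall>i::3. P i) \<longleftrightarrow> P 0 \<and> P 1 \<and> P 2"
  using forall_3[of P] by (auto simp: three_eq_0)

lemma sum_3': "sum f (UNIV::3 set) = f 0 + f 1 + f 2"
  using sum_3[of f] by (simp add: three_eq_0 ac_simps)

lemma cnj2_bK: "cnj2 bK = bK"
  unfolding cnj2_def bK_def var_t_def
  by (simp add: map_fract_to_fract ring_embedding_map_poly ring_embedding_cnj1
      ring_embeddingD[OF ring_embedding_cnj1] map_poly_pCons)

lemma bK_nonzero: "bK \<noteq> 0"
  by (simp add: bK_def var_t_def)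

lemma two_nonzero: "(2::rat2) \<noteq> 0"
proof
  assume "(2::rat2) = 0"
  then have "iota (1 + 1) = 0" by (simp add: ring_embeddingD[OF ring_embedding_iota])
  then have "(1 + 1 :: complex fls fls) = 0" by (simp only: ring_embeddingD[OF ring_embedding_iota])
  then show False by simp
qed

definition A_inv :: "rat2^3^3" where
  "A_inv = (\<chi> i j. if i = 0 \<and> j = 0 then 1
                    else if (i = 1 \<and> j = 2) \<or> (i = 2 \<and> j = 1) then inverse bK else 0)"

lemma matrix_inv_A: "matrix_inv A_mat = A_inv"
proof -
  have AB: "A_mat ** A_inv = mat 1" "A_inv ** A_mat = mat 1"
    by (simp_all add: vec_eq_iff forall_3' matrix_matrix_mult_def sum_3' A_mat_def A_inv_def
        mat_def bK_nonzero)
  then have "A_mat ** matrix_inv A_mat = mat 1 \<and> matrix_inv A_mat ** A_mat = mat 1"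
    unfolding matrix_inv_def by (intro someI_ex[where P = "\<lambda>B. A_mat ** B = mat 1 \<and> B ** A_mat = mat 1"]) blast
  then have "matrix_inv A_mat = matrix_inv A_mat ** (A_mat ** A_inv)" using AB by simp
  also have "\<dots> = A_inv" using \<open>_ \<and> _\<close> by (simp add: matrix_mul_assoc)
  finally show ?thesis .
qed

text \<open>The witnesses E_11 and E_12 - b E_13.\<close>
definition X1 :: "rat2^3^3" where
  "X1 = (\<chi> i j. if i = 0 \<and> j = 0 then 1 else 0)"

definition X2 :: "rat2^3^3" where
  "X2 = (\<chi> i j. if i = 0 \<and> j = 1 then 1 else if i = 0 \<and> j = 2 then - bK else 0)"

lemma cnj2_simps: "cnj2 0 = 0" "cnj2 1 = 1" "cnj2 (- bK) = - bK"
  by (simp_all add: ring_embeddingD[OF ring_embedding_cnj2] ring_embedding_uminus[OF ring_embedding_cnj2] cnj2_bK)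

lemma X1_sharp: "X1 ** sharp X1 = X1"
  unfolding sharp_def matrix_inv_A
  by (simp add: vec_eq_iff forall_3' matrix_matrix_mult_def sum_3' A_mat_def
      A_inv_def star_conj_transpose_def X1_def cnj2_simps)

lemma X2_sharp: "X2 ** sharp X2 = - (X1 + X1)"
  unfolding sharp_def matrix_inv_A
  by (simp add: vec_eq_iff forall_3' matrix_matrix_mult_def sum_3' A_mat_def
      A_inv_def star_conj_transpose_def X1_def X2_def cnj2_simps bK_nonzero field_simps)

text \<open>Part (ii): E E^# + E E^# + X X^# = 0 with E = X1 and X = X2.\<close>
theorem sharp_not_formally_real: "\<not> formally_real (UNIV :: (rat2^3^3) set) (+) (**) 0 sharp"
proof
  assume H: "formally_real (UNIV :: (rat2^3^3) set) (+) (**) 0 sharp"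
  have nz: "X1 ** sharp X1 \<noteq> 0" "X2 ** sharp X2 \<noteq> 0"
    unfolding X1_sharp X2_sharp by (auto simp: vec_eq_iff X1_def two_nonzero)
  have "foldr (+) (map (\<lambda>r. r ** sharp r) [X1, X1, X2]) 0 \<noteq> 0"
    by (rule H[unfolded formally_real_def, rule_format]) (use nz in auto)
  moreover have "foldr (+) (map (\<lambda>r. r ** sharp r) [X1, X1, X2]) 0 = 0"
    by (simp add: X1_sharp X2_sharp)
  ultimately show False by simp
qed

section \<open>Main theorem\<close>

theorem mainTheorem8:
  shows "formally_real D3 d3_add d3_mult d3_zero d3_star \<and>
         \<not> formally_real (UNIV :: (rat2^3^3) set) (+) (**) 0 sharp"
  using d3_star_formally_real sharp_not_formally_real by blast

end
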